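(* For a $k$-uniform hypergraph $G(V,E)$, $\chi^c(G)\ge \log_2\left\lceil \frac{|V|}{\gamma(G)}\right\rceil$.
   Context: A bicoloring of $G$ is a map $X:V\to\{0,1\}$; a bicoloring cover of $G$ is a set of bicolorings such that every hyperedge is non-monochromatic under at least one of them; $\chi^c(G)$ is the minimum size of a bicoloring cover. For an optimal bicoloring cover $C=\{X_1,\dots,X_{\chi^c(G)}\}$, each vertex $v$ gets the color bit vector $(X_1(v),\dots,X_{\chi^c(G)}(v))$, and $\gamma_C(G)$ is the maximum number of vertices sharing a common bit vector. The cover independence number $\gamma(G)$ is the maximum of $\gamma_C(G)$ over all bicoloring covers $C$ of size $\chi^c(G)$. *)

theory Defs
  imports Complex_Main "HOL-Library.FuncSet"
begin

definition hypergraph :: "'a set \<Rightarrow> 'a set set \<Rightarrow> bool" where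
  "hypergraph V E \<longleftrightarrow> finite V \<and> E \<subseteq> Pow V"

definition uniform_hypergraph :: "nat \<Rightarrow> 'a set \<Rightarrow> 'a set set \<Rightarrow> bool" where
  "uniform_hypergraph k V E \<longleftrightarrow> hypergraph V E \<and> (\<forall>e\<in>E. card e = k)"

(* Extensional functions, so that bicolorings are identified exactly when they agree on V
   and the cardinality of a set of bicolorings is the intended one. *)
definition bicolorings :: "'a set \<Rightarrow> ('a \<Rightarrow> nat) set" where
  "bicolorings V = V \<rightarrow>\<^sub>E {0, 1}"

definition monochromatic :: "('a \<Rightarrow> nat) \<Rightarrow> 'a set \<Rightarrow> bool" where
  "monochromatic X e \<longleftrightarrow> (\<forall>u\<in>e. \<forall>v\<in>e. X u = X v)"

definition bicoloring_cover :: "'a set \<Rightarrow> 'a set set \<Rightarrow> ('a \<Rightarrow> nat) set \<Rightarrow> bool" where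
  "bicoloring_cover V E C \<longleftrightarrow>
     C \<subseteq> bicolorings V \<and> (\<forall>e\<in>E. \<exists>X\<in>C. \<not> monochromatic X e)"

definition bicoloring_cover_number :: "'a set \<Rightarrow> 'a set set \<Rightarrow> nat" where
  "bicoloring_cover_number V E = (LEAST m. \<exists>C. bicoloring_cover V E C \<and> card C = m)"

definition optimal_bicoloring_cover :: "'a set \<Rightarrow> 'a set set \<Rightarrow> ('a \<Rightarrow> nat) set \<Rightarrow> bool" where
  "optimal_bicoloring_cover V E C \<longleftrightarrow>
     bicoloring_cover V E C \<and> card C = bicoloring_cover_number V E"

(* The coordinates of the bit vector are indexed by the members of C themselves, which avoids
   choosing an enumeration of C; whether two vertices share a bit vector does not depend on it. *)
definition color_bit_vector :: "('a \<Rightarrow> nat) set \<Rightarrow> 'a \<Rightarrow> (('a \<Rightarrow> nat) \<Rightarrow> nat)" where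
  "color_bit_vector C v = (\<lambda>X\<in>C. X v)"

(* The maximum ranges over all bit vectors, used or not, so it is also defined for V = {}. *)
definition gamma_cover :: "'a set \<Rightarrow> ('a \<Rightarrow> nat) set \<Rightarrow> nat" where
  "gamma_cover V C = Max ((\<lambda>b. card {v\<in>V. color_bit_vector C v = b}) ` (C \<rightarrow>\<^sub>E {0, 1}))"

(* For finite V the set below is finite, so Sup is its maximum. It is empty exactly when G has no
   bicoloring cover at all (some edge has fewer than two vertices), and then Sup is 0. *)
definition cover_independence_number :: "'a set \<Rightarrow> 'a set set \<Rightarrow> nat" where
  "cover_independence_number V E = Sup {gamma_cover V C | C. optimal_bicoloring_cover V E C}"

end

theory Submission
  imports Defs
begin

text \<open>Pigeonhole on color bit vectors. An optimal cover C with c members sorts the vertices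
  into at most 2^c classes, one per bit vector, and each class has at most
  \<open>gamma_cover V C\<close> vertices (\<open>card_le_gamma_cover\<close>). Since that is at
  most the cover independence number g, |V| \<le> 2^c * g
  (\<open>card_le_cover_independence_number\<close>). Divide by g, round up, which is harmless
  because 2^c is an integer, and take logarithms. Uniformity enters only through the finiteness of
  V.\<close>

lemma finite_bicolorings: "finite V \<Longrightarrow> finite (bicolorings V)"
  unfolding bicolorings_def by (intro finite_PiE) auto

lemma bicoloring_cover_finite:
  assumes "finite V" "bicoloring_cover V E C"
  shows "finite C"
  using assms finite_bicolorings finite_subset unfolding bicoloring_cover_def by metis

lemma color_bit_vector_in_PiE:
  assumes "C \<subseteq> bicolorings V" "v \<in> V"
  shows "color_bit_vector C v \<in> C \<rightarrow>\<^sub>E {0, 1}"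
  using assms unfolding color_bit_vector_def bicolorings_def by (intro PiE_I) auto

text \<open>The classes of vertices sharing a bit vector cover V; there are 2 ^
  \<open>card C\<close> possible vectors, and \<open>gamma_cover\<close> is by definition the
  largest class size. Optimality of C is irrelevant at this point.\<close>

lemma card_le_gamma_cover:
  assumes "finite V" "bicoloring_cover V E C"
  shows "card V \<le> 2 ^ card C * gamma_cover V C"
proof -
  let ?B = "C \<rightarrow>\<^sub>E {0, 1::nat}"
  let ?S = "\<lambda>b. {v \<in> V. color_bit_vector C v = b}"
  have finC: "finite C"
    using assms by (rule bicoloring_cover_finite)
  then have finB: "finite ?B"
    by (intro finite_PiE) auto
  have "C \<subseteq> bicolorings V"
    using assms(2) unfolding bicoloring_cover_def by simp
  from color_bit_vector_in_PiE[OF this] have "V \<subseteq> (\<Union>b\<in>?B. ?S b)"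
    by (intro subsetI UN_I CollectI conjI) (assumption | rule refl)+
  then have "card V \<le> card (\<Union>b\<in>?B. ?S b)"
    using assms(1) finB by (intro card_mono) auto
  also have "\<dots> \<le> (\<Sum>b\<in>?B. card (?S b))"
    using finB by (rule card_UN_le)
  also have "\<dots> \<le> of_nat (card ?B) * gamma_cover V C"
    unfolding gamma_cover_def using finB by (intro sum_bounded_above Max_ge) auto
  also have "card ?B = 2 ^ card C"
    using finC by (simp add: card_PiE numeral_2_eq_2)
  finally show ?thesis by simp
qed

text \<open>On naturals \<open>Sup\<close> bounds its elements only when the set is bounded; here it
  is finite, because every cover is a subset of the finite set of bicolorings.\<close>

lemma gamma_cover_le_cover_independence_number:
  assumes "finite V" "optimal_bicoloring_cover V E C"
  shows "gamma_cover V C \<le> cover_independence_number V E"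
proof -
  have "{C. optimal_bicoloring_cover V E C} \<subseteq> Pow (bicolorings V)"
    unfolding optimal_bicoloring_cover_def bicoloring_cover_def by auto
  then have "finite {C. optimal_bicoloring_cover V E C}"
    using assms(1) by (meson finite_Pow_iff finite_bicolorings finite_subset)
  then have "finite {gamma_cover V C | C. optimal_bicoloring_cover V E C}"
    by simp
  then show ?thesis
    unfolding cover_independence_number_def using assms(2)
    by (intro cSup_upper bdd_above_finite) auto
qed

lemma optimal_bicoloring_cover_exists:
  assumes "bicoloring_cover V E C"
  shows "\<exists>C'. optimal_bicoloring_cover V E C'"
  unfolding optimal_bicoloring_cover_def bicoloring_cover_number_def
  by (rule LeastI_ex) (use assms in blast)

lemma card_le_cover_independence_number:
  assumes "finite V" "bicoloring_cover V E C"
  shows "card V \<le> 2 ^ bicoloring_cover_number V E * cover_independence_number V E"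
proof -
  obtain C' where opt: "optimal_bicoloring_cover V E C'"
    using optimal_bicoloring_cover_exists[OF assms(2)] by blast
  then have "card V \<le> 2 ^ bicoloring_cover_number V E * gamma_cover V C'"
    using card_le_gamma_cover[OF assms(1)] unfolding optimal_bicoloring_cover_def by metis
  also have "\<dots> \<le> 2 ^ bicoloring_cover_number V E * cover_independence_number V E"
    using gamma_cover_le_cover_independence_number[OF assms(1) opt] by simp
  finally show ?thesis .
qed

text \<open>Without covers \<open>bicoloring_cover_number\<close> is a \<open>LEAST\<close> over an
  unsatisfiable predicate, about which nothing is known. The value 0 here lets the theorem hold in
  that case through the logarithm alone.\<close>

lemma cover_independence_number_no_cover:
  assumes "\<nexists>C. bicoloring_cover V E C"
  shows "cover_independence_number V E = 0"
  using assms unfolding cover_independence_number_def optimal_bicoloring_cover_def by simp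

theorem theorem7:
  fixes V :: "'a set" and E :: "'a set set" and k :: nat
  assumes "uniform_hypergraph k V E"
  shows "real (bicoloring_cover_number V E) \<ge>
           log 2 (real_of_int \<lceil>real (card V) / real (cover_independence_number V E)\<rceil>)"
proof -
  let ?c = "bicoloring_cover_number V E"
  let ?g = "cover_independence_number V E"
  let ?q = "real (card V) / real ?g"
  have fin: "finite V"
    using assms unfolding uniform_hypergraph_def hypergraph_def by simp
  show ?thesis
  proof (cases "?q = 0")
    case True
    \<comment> \<open>Covers the hypergraphs without bicoloring cover: there \<open>?g = 0\<close>, and \<open>x / 0 = 0\<close>, \<open>log 2 0 = 0\<close>.\<close>
    then have "\<lceil>?q\<rceil> = 0" by (metis ceiling_zero)
    then show ?thesis by (simp add: log_def)
  next
    case False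
    \<comment> \<open>Division by 0 yields 0, so a nonzero quotient forces a nonzero denominator,
      and hence the existence of a cover.\<close>
    then have "?g > 0" by simp
    then obtain C where "bicoloring_cover V E C"
      using cover_independence_number_no_cover by fastforce
    then have "real (card V) \<le> real (2 ^ ?c * ?g)"
      using card_le_cover_independence_number[OF fin] of_nat_le_iff by blast
    then have "?q \<le> 2 ^ ?c"
      using \<open>?g > 0\<close> by (simp add: divide_le_eq)
    \<comment> \<open>The ceiling is the least integer above the quotient, and 2 ^ \<open>?c\<close>
      is such an integer.\<close>
    then have "\<lceil>?q\<rceil> \<le> 2 ^ ?c"
      by (simp add: ceiling_le_iff)
    then have le: "real_of_int \<lceil>?q\<rceil> \<le> 2 ^ ?c"
      by (metis of_int_le_iff of_int_numeral of_int_power)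
    \<comment> \<open>Monotonicity of \<open>log\<close> needs a positive argument.\<close>
    have "?q > 0"
      using False by (simp add: zero_less_divide_iff)
    then have "real_of_int \<lceil>?q\<rceil> > 0"
      by linarith
    then have "log 2 (real_of_int \<lceil>?q\<rceil>) \<le> log 2 (2 ^ ?c)"
      using le by (intro log_mono) auto
    then show ?thesis
      by (simp add: log_nat_power del: log_le_cancel_iff)
  qed
qed

end
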